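(* Let $R$ be a torsion-free domain and let $k\geqslant 2$ be an integer. Define $c_k:=3k+1$ if $k\equiv 1\pmod 2$, $c_k:=3k+2$ if $k\equiv 2\pmod 4$, and $c_k:=3k+4$ if $k\equiv 0\pmod 4$. Then $\mathcal{J}_{c_k}(R)\subset[\mathcal{J}_k(R),\mathcal{J}_k(R)]$.
   Context: $R$ is a commutative unital Hausdorff topological ring (discrete topology if no topology is specified). A torsion-free domain is an integral domain $R$ such that the unique ring morphism $\mathbb{Z}\to R$ is injective. For $k\geqslant 2$, $\mathcal{J}_k(R)$ is the group, under composition of formal power series, of all $f\in R[[x]]$ of the form $f=x+\sum_{i\geqslant k}\alpha_i x^i$, a topological group with the topology induced from the product topology on $R[[x]]\cong R^{\mathbb{N}}$. $[\mathcal{J}_k(R),\mathcal{J}_k(R)]$ denotes the closure of the subgroup generated by all commutators $[f,g]=f\circ g\circ f^{-1}\circ g^{-1}$ of elements of $\mathcal{J}_k(R)$. *)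

theory Defs
  imports
    "HOL-Analysis.Analysis"
    "HOL-Computational_Algebra.Formal_Power_Series"
    "HOL-Algebra.Generated_Groups"
begin

definition hausdorff_ring_topology :: "'a::comm_ring_1 topology \<Rightarrow> bool" where
  "hausdorff_ring_topology T \<longleftrightarrow>
     topspace T = UNIV \<and> Hausdorff_space T \<and>
     continuous_map (prod_topology T T) T (\<lambda>(a, b). a + b) \<and>
     continuous_map T T (\<lambda>a. - a) \<and>
     continuous_map (prod_topology T T) T (\<lambda>(a, b). a * b)"

(* The metric that the library puts on the type fps induces the product topology only for discrete
   coefficients, so the topology on R[[x]] is built from the topology T on R instead. *)
definition fps_topology :: "'a topology \<Rightarrow> 'a fps topology" where
  "fps_topology T = pullback_topology UNIV fps_nth (product_topology (\<lambda>_. T) UNIV)"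

(* Intended for k \<ge> 2. *)
definition J_group :: "nat \<Rightarrow> 'a::idom fps monoid" where
  "J_group k = \<lparr>carrier = {f. fps_nth f 0 = 0 \<and> fps_nth f 1 = 1 \<and> (\<forall>i. 1 < i \<and> i < k \<longrightarrow> fps_nth f i = 0)},
          mult = (\<lambda>f g. f oo g),
          one = fps_X\<rparr>"

definition J_topology :: "'a::idom topology \<Rightarrow> nat \<Rightarrow> 'a fps topology" where
  "J_topology T k = subtopology (fps_topology T) (carrier (J_group k))"

definition closed_commutator :: "'a::idom topology \<Rightarrow> nat \<Rightarrow> 'a fps set" where
  "closed_commutator T k = J_topology T k closure_of derived (J_group k) (carrier (J_group k))"

definition c_index :: "nat \<Rightarrow> nat" where
  "c_index k = (if k mod 2 = 1 then 3 * k + 1 else if k mod 4 = 2 then 3 * k + 2 else 3 * k + 4)"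

lemma hausdorff_ring_topology_discrete:
  "hausdorff_ring_topology (discrete_topology UNIV)"
  by (simp add: hausdorff_ring_topology_def flip: prod_topology_discrete_topology)

lemma power_nth_eq_fps_X_power:
  fixes f :: "'a::idom fps"
  assumes "f \<in> carrier (J_group k)" "n < k"
  shows "fps_nth (f ^ i) n = fps_nth (fps_X ^ i) n"
  using assms(2)
proof (induction i arbitrary: n)
  case (Suc i)
  have "fps_nth f j = fps_nth fps_X j" if "j \<le> n" for j
    using assms(1) Suc.prems that unfolding J_group_def
    by (cases "j = 0"; cases "j = 1") (auto simp: fps_X_def)
  then show ?case
    unfolding power_Suc fps_mult_nth using Suc by (intro sum.cong) auto
qed simp

lemma J_compose_nth:
  fixes f g :: "'a::idom fps"
  assumes "g \<in> carrier (J_group k)" "n < k"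
  shows "fps_nth (f oo g) n = fps_nth f n"
  unfolding fps_compose_nth
  by (simp add: power_nth_eq_fps_X_power[OF assms] mult_delta_right)

lemma J_compose_closed:
  fixes f g :: "'a::idom fps"
  assumes "2 \<le> k" "f \<in> carrier (J_group k)" "g \<in> carrier (J_group k)"
  shows "f oo g \<in> carrier (J_group k)"
  using assms J_compose_nth[OF assms(3)] by (auto simp: J_group_def)

lemma J_left_inverse:
  fixes f :: "'a::idom fps"
  assumes "2 \<le> k" "f \<in> carrier (J_group k)"
  shows "\<exists>g \<in> carrier (J_group k). g oo f = fps_X"
proof -
  have f: "fps_nth f 0 = 0" "fps_nth f 1 = 1" using assms by (auto simp: J_group_def)
  define b where "b = wfrec less_than
     (\<lambda>b n. fps_nth fps_X n - (\<Sum>i<n. b i * fps_nth (f ^ i) n) :: 'a)"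
  have b: "b n = fps_nth fps_X n - (\<Sum>i<n. b i * fps_nth (f ^ i) n)" for n
    unfolding b_def by (subst wfrec) (auto simp: cut_apply intro!: sum.cong)
  define g where "g = Abs_fps b"
  have diag: "fps_nth (f ^ n) n = 1" for n
    using f startsby_zero_power_nth_same[of f n] by simp
  have gf: "g oo f = fps_X"
  proof (intro fps_ext)
    fix n
    have "fps_nth (g oo f) n = (\<Sum>i<n. b i * fps_nth (f ^ i) n) + b n * fps_nth (f ^ n) n"
      unfolding fps_compose_nth atLeast0AtMost lessThan_Suc_atMost[symmetric] g_def by simp
    also have "\<dots> = fps_nth fps_X n"
      unfolding diag by (subst (2) b) simp
    finally show "fps_nth (g oo f) n = fps_nth fps_X n" .
  qed
  have "fps_nth g n = fps_nth fps_X n" if "n < k" for n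
    using J_compose_nth[OF assms(2) that, of g] gf by simp
  then have "g \<in> carrier (J_group k)" using assms(1) by (auto simp: J_group_def)
  with gf show ?thesis by blast
qed

lemma group_J_group:
  assumes "2 \<le> k"
  shows "group (J_group k :: 'a::idom fps monoid)"
proof (rule groupI)
  fix f g h :: "'a fps"
  assume "f \<in> carrier (J_group k)" "g \<in> carrier (J_group k)" "h \<in> carrier (J_group k)"
  then show "(f \<otimes>\<^bsub>J_group k\<^esub> g) \<otimes>\<^bsub>J_group k\<^esub> h = f \<otimes>\<^bsub>J_group k\<^esub> (g \<otimes>\<^bsub>J_group k\<^esub> h)"
    by (simp add: J_group_def fps_compose_assoc)
next
  fix f g :: "'a fps"
  assume "f \<in> carrier (J_group k)" "g \<in> carrier (J_group k)"
  then show "f \<otimes>\<^bsub>J_group k\<^esub> g \<in> carrier (J_group k)"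
    using J_compose_closed[OF assms, of f g] by (simp add: J_group_def)
next
  show "\<one>\<^bsub>J_group k\<^esub> \<in> carrier (J_group k :: 'a fps monoid)" using assms by (simp add: J_group_def)
next
  fix f :: "'a fps"
  assume "f \<in> carrier (J_group k)"
  then show "\<one>\<^bsub>J_group k\<^esub> \<otimes>\<^bsub>J_group k\<^esub> f = f" by (simp add: J_group_def)
next
  fix f :: "'a fps"
  assume "f \<in> carrier (J_group k)"
  then show "\<exists>g \<in> carrier (J_group k). g \<otimes>\<^bsub>J_group k\<^esub> f = \<one>\<^bsub>J_group k\<^esub>"
    using J_left_inverse[OF assms] by (simp add: J_group_def)
qed

end

(* For i > j >= 2 and d = i + j - 1 the commutator of x + a x^i and x + x^j equals
     x + (i - j) a x^d + (C(i,2) - (i - j) d) a x^(d+j-1)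
   up to high order. Its leading coefficient alone yields every even degree (i - j = 1), but in odd
   degrees only the coefficients in 2R (i - j = 2). For an odd degree m one reads the second
   coefficient instead: with m = d + j - 1 it is an odd multiple of a as soon as i = 3 mod 4. The
   intermediate terms between the degrees d and m are removed by commutators with i - j = 1 or 2,
   which is possible because in this range composition is additive up to degree m and these
   commutators have no further terms up to degree m. Successive approximation finishes the proof;
   it only uses that finitely many coefficients determine a basic neighbourhood. *)

theory Submission
  imports Defs
begin

section \<open>Truncated binomial expansions\<close>

text \<open>The remainder is an explicit multiple of \<open>c ^ 3\<close> with an anonymous cofactor
  \<open>v\<close>. A truncated expansion thus becomes an exact ring identity, and congruences
  between power series can be settled by pure ring normalisation.\<close>

lemma one_add_power_expand:
  fixes c :: "'a::comm_ring_1"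
  shows "\<exists>v. (1 + c) ^ n = 1 + of_nat n * c + of_nat (n choose 2) * c\<^sup>2 + c ^ 3 * v"
proof (induction n)
  case 0
  show ?case by (intro exI[of _ 0]) (simp add: numeral_2_eq_2)
next
  case (Suc n)
  then obtain v where v: "(1 + c) ^ n = 1 + of_nat n * c + of_nat (n choose 2) * c\<^sup>2 + c ^ 3 * v" ..
  have "(1 + c) ^ Suc n = 1 + of_nat (Suc n) * c + of_nat (Suc n choose 2) * c\<^sup>2
      + c ^ 3 * (of_nat (n choose 2) + v + c * v)"
    by (simp add: v numeral_2_eq_2 numeral_3_eq_3 algebra_simps)
  then show ?case ..
qed

lemma one_add_power_expand1:
  fixes c :: "'a::comm_ring_1"
  shows "\<exists>v. (1 + c) ^ n = 1 + of_nat n * c + c\<^sup>2 * v"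
proof -
  obtain v where "(1 + c) ^ n = 1 + of_nat n * c + of_nat (n choose 2) * c\<^sup>2 + c ^ 3 * v"
    using one_add_power_expand by blast
  then have "(1 + c) ^ n = 1 + of_nat n * c + c\<^sup>2 * (of_nat (n choose 2) + c * v)"
    by (simp add: power2_eq_square power3_eq_cube algebra_simps)
  then show ?thesis ..
qed

lemma one_add_power_expand0:
  fixes c :: "'a::comm_ring_1"
  shows "\<exists>v. (1 + c) ^ n = 1 + c * v"
proof -
  obtain v where "(1 + c) ^ n = 1 + of_nat n * c + c\<^sup>2 * v"
    using one_add_power_expand1 by blast
  then have "(1 + c) ^ n = 1 + c * (of_nat n + c * v)"
    by (simp add: power2_eq_square algebra_simps)
  then show ?thesis ..
qed

section \<open>Coefficients of powers and composites in \<open>J_group d\<close>\<close>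

lemma fps_X_power_dvd_iff:
  fixes f :: "'a::comm_ring_1 fps"
  shows "fps_X ^ N dvd f \<longleftrightarrow> (\<forall>n<N. fps_nth f n = 0)"
proof
  assume "\<forall>n<N. fps_nth f n = 0"
  then have "f = fps_X ^ N * fps_shift N f"
    by (intro fps_ext) (simp add: fps_X_power_mult_nth)
  then show "fps_X ^ N dvd f" by (metis dvd_triv_left)
qed (auto simp: fps_X_power_mult_nth elim!: dvdE)

lemma in_J_group_iff:
  assumes "2 \<le> d"
  shows "f \<in> carrier (J_group d) \<longleftrightarrow> (\<forall>n<d. fps_nth f n = fps_nth fps_X n)"
proof
  assume "\<forall>n<d. fps_nth f n = fps_nth fps_X n"
  then show "f \<in> carrier (J_group d)"
    using assms by (auto simp: J_group_def)
next
  assume "f \<in> carrier (J_group d)"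
  then show "\<forall>n<d. fps_nth f n = fps_nth fps_X n"
    using assms by (auto simp: J_group_def fps_X_nth) (metis One_nat_def Suc_lessI gr0I)
qed

lemma J_group_antimono:
  "d \<le> e \<Longrightarrow> carrier (J_group e) \<subseteq> carrier (J_group d)"
  by (auto simp: J_group_def)

lemma J_group_factor:
  fixes f :: "'a::idom fps"
  assumes "2 \<le> d" "f \<in> carrier (J_group d)"
  obtains b where "f = fps_X * (1 + fps_X ^ (d - 1) * b)"
proof -
  have "fps_X ^ d dvd f - fps_X"
    using assms by (simp add: fps_X_power_dvd_iff in_J_group_iff)
  then obtain b where "f - fps_X = fps_X ^ d * b" ..
  then have "f = fps_X + fps_X ^ Suc (d - 1) * b"
    using assms(1) by (simp add: diff_eq_eq add.commute)
  then have "f = fps_X * (1 + fps_X ^ (d - 1) * b)"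
    by (simp only: power_Suc distrib_left mult.assoc mult_1_right)
  then show thesis by (rule that)
qed

text \<open>Writing f = x (1 + x^(d-1) b) gives f^i = x^i (1 + x^(d-1) b v), so f^i first deviates
  from x^i in degree i + d - 1 or later.\<close>

lemma J_group_power_nth:
  fixes f :: "'a::idom fps"
  assumes "2 \<le> d" "f \<in> carrier (J_group d)" "n < i + d - 1"
  shows "fps_nth (f ^ i) n = (if n = i then 1 else 0)"
proof -
  obtain b where b: "f = fps_X * (1 + fps_X ^ (d - 1) * b)"
    using J_group_factor assms(1,2) .
  obtain v where v: "(1 + fps_X ^ (d - 1) * b) ^ i = 1 + fps_X ^ (d - 1) * b * v"
    using one_add_power_expand0 by blast
  have "f ^ i = fps_X ^ i + fps_X ^ (i + (d - 1)) * (b * v)"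
    unfolding b power_mult_distrib v power_add by (simp only: distrib_left mult.assoc mult_1_right)
  then show ?thesis
    using assms(1,3) by (simp only: fps_add_nth fps_X_power_mult_nth fps_X_power_nth) auto
qed

text \<open>Among the summands \<open>fps_nth f i * fps_nth (g ^ i) n\<close>, the one with i = 1
  gives the coefficient of g. Those with 1 < i < d vanish, and for i \<ge> d the power g^i still
  looks like x^i in degree n < d + e - 1, so only i = n survives.\<close>

lemma J_compose_nth_add:
  fixes f g :: "'a::idom fps"
  assumes "2 \<le> d" "f \<in> carrier (J_group d)" "2 \<le> e" "g \<in> carrier (J_group e)"
    and "2 \<le> n" "n < d + e - 1"
  shows "fps_nth (f oo g) n = fps_nth f n + fps_nth g n"
proof -
  have f: "fps_nth f 0 = 0" "fps_nth f 1 = 1" "\<And>i. 1 < i \<Longrightarrow> i < d \<Longrightarrow> fps_nth f i = 0"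
    using assms(2) by (auto simp: J_group_def)
  have "fps_nth f i * fps_nth (g ^ i) n
      = (if i = 1 then fps_nth g n else 0) + (if i = n then fps_nth f n else 0)"
    if "i \<in> {0..n}" for i
  proof (cases "i < d")
    case True
    then consider "i = 0" | "i = 1" | "1 < i" by linarith
    then show ?thesis using f True assms(5) by cases auto
  next
    case False
    then show ?thesis
      using J_group_power_nth[OF assms(3,4), of n i] assms by auto
  qed
  then have "fps_nth (f oo g) n = (\<Sum>i=0..n. (if i = 1 then fps_nth g n else 0)
      + (if i = n then fps_nth f n else 0))"
    unfolding fps_compose_nth by (rule sum.cong[OF refl])
  also have "\<dots> = fps_nth f n + fps_nth g n"
    using assms(5) by (simp add: sum.distrib)
  finally show ?thesis .
qed


section \<open>The first two terms of a commutator\<close>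

text \<open>Instantiated with y = x^(j-1) and z = x^(i-1), this compares f o g with H o G, where f =
  x + A x^i, g = x + x^j, G = g o f and H is the claimed commutator. Then x^d = X y z and x^e = X
  y^2 z, so the comparison is an identity in an arbitrary commutative ring and all exponents
  disappear.\<close>

lemma commutator_congruence:
  fixes X y z A :: "'a::comm_ring_1" and i j d e :: nat
  assumes "j \<le> i"
  defines "G \<equiv> X * (1 + A * z) + X * y * (1 + A * z) ^ j"
    and "N \<equiv> of_nat (i choose 2) - of_nat (i - j) * of_nat d"
  obtains P Q c where "G = X * (1 + c)"
    and "(X * (1 + y) + A * (X * z) * (1 + y) ^ i)
      - (G + of_nat (i - j) * A * (X * y * z) * (1 + c) ^ d + N * A * (X * y\<^sup>2 * z) * (1 + c) ^ e)
      = X * y * z * (y\<^sup>2 * P + z * Q)"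
proof -
  define a b :: 'a where "a = of_nat i" and "b = of_nat j"
  have I: "of_nat (i - j) = a - b" using assms(1) by (simp add: a_def b_def of_nat_diff)
  obtain v where v: "(1 + y) ^ i = 1 + a * y + of_nat (i choose 2) * y\<^sup>2 + y ^ 3 * v"
    unfolding a_def using one_add_power_expand by blast
  obtain w where w: "(1 + A * z) ^ j = 1 + b * (A * z) + (A * z)\<^sup>2 * w"
    unfolding b_def using one_add_power_expand1 by blast
  \<comment> \<open>Chosen so that 1 + y + z u is the factor of \<open>X\<close> in the expanded
    \<open>G\<close>.\<close>
  define u where "u = A + b * A * y + y * z * A\<^sup>2 * w"
  define c where "c = y + z * u"
  obtain s where s: "(1 + c) ^ d = 1 + of_nat d * c + c\<^sup>2 * s"
    using one_add_power_expand1 by blast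
  obtain t where t: "(1 + c) ^ e = 1 + c * t"
    using one_add_power_expand0 by blast
  have C: "of_nat (i choose 2) = N + (a - b) * of_nat d"
    unfolding N_def I by simp
  have G: "G = X * (1 + c)"
    unfolding G_def w c_def u_def by (simp add: algebra_simps power2_eq_square)
  show thesis
  proof (rule that[OF G])
    show "(X * (1 + y) + A * (X * z) * (1 + y) ^ i)
      - (G + of_nat (i - j) * A * (X * y * z) * (1 + c) ^ d + N * A * (X * y\<^sup>2 * z) * (1 + c) ^ e)
      = X * y * z * (y\<^sup>2 * (v * A - (a - b) * A * s - N * A * t)
          + z * (- A\<^sup>2 * w - (a - b) * A * of_nat d * u - (a - b) * A * s * (2 * y * u + z * u\<^sup>2)
                 - N * A * u * y * t))"
      unfolding v s t I unfolding G_def w c_def C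
      by (simp add: algebra_simps power2_eq_square power3_eq_cube)
  qed
qed

text \<open>Right composition with g is unitriangular on coefficients, because g^n starts with x^n.
  Hence it can be cancelled degree by degree.\<close>

lemma J_compose_cancel_nth:
  fixes f h g :: "'a::idom fps"
  assumes "g \<in> carrier (J_group k)" and "\<forall>n<M. fps_nth (f oo g) n = fps_nth (h oo g) n"
  shows "\<forall>n<M. fps_nth f n = fps_nth h n"
proof (intro allI impI)
  fix n assume "n < M"
  then show "fps_nth f n = fps_nth h n"
  proof (induction n rule: less_induct)
    case (less n)
    have g: "fps_nth g 0 = 0" "fps_nth g 1 = 1" using assms(1) by (auto simp: J_group_def)
    have diag: "fps_nth (g ^ n) n = 1"
      using startsby_zero_power_nth_same[of g n] g by simp
    have split: "fps_nth (p oo g) n = (\<Sum>i<n. fps_nth p i * fps_nth (g ^ i) n) + fps_nth p n"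
      for p :: "'a fps"
      unfolding fps_compose_nth atLeast0AtMost lessThan_Suc_atMost[symmetric] by (simp add: diag)
    have "(\<Sum>i<n. fps_nth f i * fps_nth (g ^ i) n) = (\<Sum>i<n. fps_nth h i * fps_nth (g ^ i) n)"
      using less by (intro sum.cong) auto
    moreover have "fps_nth (f oo g) n = fps_nth (h oo g) n" using assms(2) less.prems by blast
    ultimately show ?case unfolding split by simp
  qed
qed

text \<open>Characterises the commutator by an equation free of inverses, so that no compositional
  inverse has to be expanded.\<close>

lemma (in group) commutator_mult_cancel:
  assumes "f \<in> carrier G" "g \<in> carrier G"
  shows "f \<otimes> g \<otimes> inv f \<otimes> inv g \<otimes> (g \<otimes> f) = f \<otimes> g"
  using assms by (simp add: m_assoc inv_solve_left' flip: m_assoc) (simp add: m_assoc)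

text \<open>With G = g o f, the commutator h satisfies h o G = f o g, and the claimed series H
  satisfies the same equation modulo x^(d+K). Cancelling G transfers the congruence to h and
  H.\<close>

lemma commutator_nth:
  fixes \<alpha> :: "'a::idom"
  assumes "2 \<le> k" "k \<le> j" "j < i"
  defines "D \<equiv> derived (J_group k :: 'a fps monoid) (carrier (J_group k))"
  obtains h where "h \<in> D"
    and "\<And>n. n < i + j - 1 + min (i - 1) (2 * j - 2) \<Longrightarrow> fps_nth h n =
      fps_nth (fps_X + fps_const (of_nat (i - j) * \<alpha>) * fps_X ^ (i + j - 1)
        + fps_const ((of_nat (i choose 2) - of_nat (i - j) * of_nat (i + j - 1)) * \<alpha>)
            * fps_X ^ (i + 2 * j - 2)) n"
proof -
  interpret group "J_group k :: 'a fps monoid" using group_J_group[OF assms(1)] .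
  define f :: "'a fps" where "f = fps_X + fps_const \<alpha> * fps_X ^ i"
  define g :: "'a fps" where "g = fps_X + fps_X ^ j"
  have f: "f \<in> carrier (J_group k)" and g: "g \<in> carrier (J_group k)"
    using assms(1-3) by (auto simp: f_def g_def in_J_group_iff)
  define h where "h = f \<otimes>\<^bsub>J_group k\<^esub> g \<otimes>\<^bsub>J_group k\<^esub> inv\<^bsub>J_group k\<^esub> f \<otimes>\<^bsub>J_group k\<^esub> inv\<^bsub>J_group k\<^esub> g"
  have hD: "h \<in> D" unfolding D_def derived_def h_def
    using f g by (intro generate.incl) blast
  have hG: "h oo (g oo f) = f oo g"
    using commutator_mult_cancel[OF f g] unfolding h_def by (simp add: J_group_def)
  define G where "G = g oo f"
  have G: "G \<in> carrier (J_group k)" unfolding G_def using J_compose_closed[OF assms(1) g f] .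
  have zero: "fps_nth f 0 = 0" "fps_nth g 0 = 0" "fps_nth G 0 = 0"
    using f g G by (auto simp: J_group_def)
  define y z :: "'a fps" where "y = fps_X ^ (j - 1)" and "z = fps_X ^ (i - 1)"
  define A where "A = fps_const \<alpha>"
  define d where "d = i + j - 1"
  define e where "e = i + 2 * j - 2"
  define N :: "'a fps" where "N = of_nat (i choose 2) - of_nat (i - j) * of_nat d"
  have Xi: "fps_X ^ i = fps_X * z" and Xj: "fps_X ^ j = fps_X * y"
    using assms(1-3) by (simp_all add: y_def z_def flip: power_Suc)
  have Xd: "fps_X ^ d = fps_X * y * z" and Xe: "fps_X ^ e = fps_X * y\<^sup>2 * z"
  proof -
    have "fps_X * y * z = fps_X ^ (Suc (j - 1 + (i - 1)))"
      "fps_X * y\<^sup>2 * z = fps_X ^ (Suc (2 * (j - 1) + (i - 1)))"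
      unfolding y_def z_def power2_eq_square mult_2 power_Suc power_add by (simp_all only: mult.assoc)
    moreover have "Suc (j - 1 + (i - 1)) = d" "Suc (2 * (j - 1) + (i - 1)) = e"
      using assms(1-3) by (auto simp: d_def e_def)
    ultimately show "fps_X ^ d = fps_X * y * z" "fps_X ^ e = fps_X * y\<^sup>2 * z" by metis+
  qed
  have gX: "g = fps_X * (1 + y)"
    unfolding g_def Xj by (simp only: distrib_left mult_1_right)
  have "f oo g = g + A * g ^ i"
    unfolding f_def A_def using zero
    by (simp add: fps_compose_add_distrib fps_compose_mult_distrib fps_X_power_compose)
  then have fg: "f oo g = fps_X * (1 + y) + A * (fps_X * z) * (1 + y) ^ i"
    unfolding gX power_mult_distrib Xi by (simp only: mult.assoc)
  have fX: "f = fps_X * (1 + A * z)"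
    unfolding f_def A_def[symmetric] Xi by (simp only: distrib_left mult_1_right mult.left_commute)
  have "G = f + f ^ j"
    unfolding G_def g_def using zero by (simp add: fps_compose_add_distrib fps_X_power_compose)
  then have G_eq: "G = fps_X * (1 + A * z) + fps_X * y * (1 + A * z) ^ j"
    unfolding fX power_mult_distrib Xj .
  obtain P Q c where c: "G = fps_X * (1 + c)"
    and PQ: "(f oo g) - (G + of_nat (i - j) * A * (fps_X * y * z) * (1 + c) ^ d
        + N * A * (fps_X * y\<^sup>2 * z) * (1 + c) ^ e) = fps_X * y * z * (y\<^sup>2 * P + z * Q)"
    by (rule commutator_congruence[OF less_imp_le[OF assms(3)], of fps_X A z y d e,
          folded N_def, folded G_eq fg]) (rule that)
  define H where "H = fps_X + of_nat (i - j) * A * fps_X ^ d + N * A * fps_X ^ e"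
  have const: "of_nat (i - j) * A = fps_const (of_nat (i - j) * \<alpha>)"
    "N * A = fps_const ((of_nat (i choose 2) - of_nat (i - j) * of_nat d) * \<alpha>)"
    unfolding N_def A_def fps_of_nat[symmetric] by simp_all
  have "H oo G = G + of_nat (i - j) * A * G ^ d + N * A * G ^ e"
    unfolding H_def const using zero
    by (simp add: fps_compose_add_distrib fps_compose_mult_distrib fps_X_power_compose)
  also have "\<dots> = G + of_nat (i - j) * A * (fps_X * y * z) * (1 + c) ^ d
        + N * A * (fps_X * y\<^sup>2 * z) * (1 + c) ^ e"
    by (simp only: c power_mult_distrib Xd Xe mult.assoc)
  finally have diff: "(f oo g) - (H oo G) = fps_X ^ d * (y\<^sup>2 * P + z * Q)"
    using PQ unfolding Xd by simp
  \<comment> \<open>The error has the factor y^2 P + z Q, where y^2 = x^(2j-2) and z = x^(i-1); this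
    fixes the precision.\<close>
  define K where "K = min (i - 1) (2 * j - 2)"
  have "fps_X ^ K dvd y\<^sup>2" "fps_X ^ K dvd z"
    unfolding y_def z_def K_def power_mult[symmetric] by (intro le_imp_power_dvd; simp)+
  then have "fps_X ^ (d + K) dvd (f oo g) - (H oo G)"
    unfolding diff power_add by (intro mult_dvd_mono dvd_refl dvd_add dvd_mult2)
  then have "\<forall>n<d + K. fps_nth (h oo G) n = fps_nth (H oo G) n"
    using hG unfolding G_def[symmetric] fps_X_power_dvd_iff by simp
  then have "\<forall>n<d + K. fps_nth h n = fps_nth H n" by (rule J_compose_cancel_nth[OF G])
  then show thesis using that[OF hD] unfolding H_def const d_def e_def K_def by simp
qed

section \<open>Correction terms and elimination of intermediate degrees\<close>

text \<open>The exponents a + 1 and a give leading coefficient \<gamma> in degree 2a. The second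
  term sits in degree 3a - 1, beyond m.\<close>

lemma correction_even:
  fixes \<gamma> :: "'a::idom"
  assumes "2 \<le> k" "k \<le> a" "m + 2 \<le> 3 * a"
  obtains h where "h \<in> derived (J_group k) (carrier (J_group k))"
    and "\<And>n. n \<le> m \<Longrightarrow> fps_nth h n = fps_nth (fps_X + fps_const \<gamma> * fps_X ^ (2 * a)) n"
proof -
  from commutator_nth[OF assms(1,2) lessI, of \<gamma>] obtain h
    where h: "h \<in> derived (J_group k) (carrier (J_group k))"
    and nth: "\<And>n. n < Suc a + a - 1 + min (Suc a - 1) (2 * a - 2) \<Longrightarrow> fps_nth h n =
      fps_nth (fps_X + fps_const (of_nat (Suc a - a) * \<gamma>) * fps_X ^ (Suc a + a - 1)
        + fps_const ((of_nat (Suc a choose 2) - of_nat (Suc a - a) * of_nat (Suc a + a - 1)) * \<gamma>)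
            * fps_X ^ (Suc a + 2 * a - 2)) n"
    by blast
  show thesis
  proof (rule that[OF h])
    fix n assume "n \<le> m"
    then have bound: "n < Suc a + a - 1 + min (Suc a - 1) (2 * a - 2)" and "n \<noteq> 3 * a - 1"
      using assms by auto
    moreover have exps: "Suc a + a - 1 = 2 * a" "Suc a - a = 1" "Suc a + 2 * a - 2 = 3 * a - 1"
      by simp_all
    ultimately show "fps_nth h n = fps_nth (fps_X + fps_const \<gamma> * fps_X ^ (2 * a)) n"
      using nth[OF bound, unfolded exps] by simp
  qed
qed

text \<open>The exponents a + 2 and a give leading coefficient 2\<gamma> in degree 2a + 1. The
  second term sits in degree 3a, beyond m.\<close>

lemma correction_odd:
  fixes \<gamma> :: "'a::idom"
  assumes "2 \<le> k" "k \<le> a" "m < 3 * a"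
  obtains h where "h \<in> derived (J_group k) (carrier (J_group k))"
    and "\<And>n. n \<le> m \<Longrightarrow> fps_nth h n = fps_nth (fps_X + fps_const (2 * \<gamma>) * fps_X ^ (2 * a + 1)) n"
proof -
  have "a < a + 2" by simp
  from commutator_nth[OF assms(1,2) this, of \<gamma>] obtain h
    where h: "h \<in> derived (J_group k) (carrier (J_group k))"
    and nth: "\<And>n. n < a + 2 + a - 1 + min (a + 2 - 1) (2 * a - 2) \<Longrightarrow> fps_nth h n =
      fps_nth (fps_X + fps_const (of_nat (a + 2 - a) * \<gamma>) * fps_X ^ (a + 2 + a - 1)
        + fps_const ((of_nat (a + 2 choose 2) - of_nat (a + 2 - a) * of_nat (a + 2 + a - 1)) * \<gamma>)
            * fps_X ^ (a + 2 + 2 * a - 2)) n"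
    by blast
  show thesis
  proof (rule that[OF h])
    fix n assume "n \<le> m"
    then have bound: "n < a + 2 + a - 1 + min (a + 2 - 1) (2 * a - 2)" and "n \<noteq> 3 * a"
      using assms by auto
    moreover have exps: "a + 2 + a - 1 = 2 * a + 1" "a + 2 - a = 2" "a + 2 + 2 * a - 2 = 3 * a"
      by simp_all
    ultimately show "fps_nth h n = fps_nth (fps_X + fps_const (2 * \<gamma>) * fps_X ^ (2 * a + 1)) n"
      using nth[OF bound, unfolded exps] by simp
  qed
qed

lemma J_derived_subgroup:
  assumes "2 \<le> k"
  shows "subgroup (derived (J_group k) (carrier (J_group k))) (J_group k :: 'a::idom fps monoid)"
  using group.derived_is_subgroup[OF group_J_group[OF assms]] by blast

lemma J_derived_compose:
  fixes f g :: "'a::idom fps"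
  assumes "2 \<le> k" "f \<in> derived (J_group k) (carrier (J_group k))"
    "g \<in> derived (J_group k) (carrier (J_group k))"
  shows "f oo g \<in> derived (J_group k) (carrier (J_group k))"
  using subgroup.m_closed[OF J_derived_subgroup[OF assms(1)] assms(2,3)] by (simp add: J_group_def)

text \<open>One correction per degree raises d until it reaches m. The bound
  \<open>2 * m + 4 \<le> 3 * d\<close> keeps the second terms of the corrections above m, and
  \<open>2 * k < d\<close> keeps their exponents at least k. In odd degrees only coefficients in 2R
  can be removed, whence the divisibility hypotheses.\<close>

lemma eliminate:
  fixes h :: "'a::idom fps"
  assumes k: "2 \<le> k" and "odd m"
    and "d \<le> m" "2 * m + 4 \<le> 3 * d" "2 * k < d"
    and "h \<in> derived (J_group k) (carrier (J_group k))" "h \<in> carrier (J_group d)"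
    and "\<And>n. n < m \<Longrightarrow> odd n \<Longrightarrow> d \<le> n \<Longrightarrow> 2 dvd fps_nth h n" "2 dvd fps_nth h m - \<alpha>"
  shows "\<exists>h' \<in> derived (J_group k) (carrier (J_group k)). h' \<in> carrier (J_group m) \<and> fps_nth h' m = \<alpha>"
  using assms(3-)
proof (induction d arbitrary: h rule: inc_induct)
  case base
  note num = base(1,2) and hD = base(3) and hJ = base(4) and hm = base(6)
  \<comment> \<open>All lower terms are gone; the remaining defect in the odd degree m is even, so a
    single odd correction repairs it.\<close>
  obtain \<beta> where \<beta>: "fps_nth h m - \<alpha> = 2 * \<beta>" using hm by (rule dvdE)
  obtain a where a: "m = 2 * a + 1" using assms(2) by (auto elim: oddE)
  have "k \<le> a" "m < 3 * a" and m: "2 \<le> m" using num k a by linarith+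
  then obtain c where c: "c \<in> derived (J_group k) (carrier (J_group k))"
    and cn: "\<And>n. n \<le> m \<Longrightarrow> fps_nth c n = fps_nth (fps_X + fps_const (2 * - \<beta>) * fps_X ^ m) n"
    using correction_odd[of k a m "- \<beta>"] k unfolding a by blast
  have cJ: "c \<in> carrier (J_group m)"
    using m cn by (simp add: in_J_group_iff)
  have "fps_nth c m = - (2 * \<beta>)"
    using cn[of m] m by simp
  moreover have "fps_nth (h oo c) m = fps_nth h m + fps_nth c m"
    using J_compose_nth_add[OF m hJ m cJ m] m by simp
  ultimately have "fps_nth (h oo c) m = \<alpha>"
    using \<beta> by (simp add: algebra_simps)
  then show ?case
    using J_derived_compose[OF k hD c] J_compose_closed[OF m hJ cJ] by blast
next
  case (step d)
  note num = step(1,2,4,5) and hD = step(6) and hJ = step(7) and hodd = step(8) and hm = step(9)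
  have d: "2 \<le> d" using num k by linarith
  obtain c where c: "c \<in> derived (J_group k) (carrier (J_group k))"
    and cn: "\<And>n. n \<le> m \<Longrightarrow> fps_nth c n = fps_nth (fps_X + fps_const (- fps_nth h d) * fps_X ^ d) n"
  proof (cases "even d")
    case True
    then obtain a where a: "d = 2 * a" by (auto elim: evenE)
    have "k \<le> a" "m + 2 \<le> 3 * a" using num a by linarith+
    then show thesis
      using correction_even[of k a m "- fps_nth h d"] that k unfolding a by blast
  next
    case False
    then obtain a where a: "d = 2 * a + 1" by (auto elim: oddE)
    obtain \<beta> where "fps_nth h d = 2 * \<beta>" using hodd[of d] num False by (auto elim: dvdE)
    then have \<beta>: "- fps_nth h d = 2 * (- \<beta>)" by simp
    have "k \<le> a" "m < 3 * a" using num a by linarith+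
    then show thesis
      using correction_odd[of k a m "- \<beta>"] that k unfolding \<beta> unfolding a by blast
  qed
  have cJ: "c \<in> carrier (J_group d)"
    using d num cn by (simp add: in_J_group_iff)
  \<comment> \<open>Since m < 2d - 1, composition is additive here: \<open>c\<close> deletes the
    coefficient in degree d and leaves the others up to m, hence the parity conditions,
    intact.\<close>
  have hc: "fps_nth (h oo c) n = (if n = d then 0 else fps_nth h n)" if "d \<le> n" "n \<le> m" for n
  proof -
    have "fps_nth (h oo c) n = fps_nth h n + fps_nth c n"
      using d num that by (intro J_compose_nth_add[OF d hJ d cJ]) linarith+
    then show ?thesis using cn[of n] d that by simp
  qed
  have "h oo c \<in> carrier (J_group d)"
    using J_compose_closed[OF d hJ cJ] .
  then have "h oo c \<in> carrier (J_group (Suc d))"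
    using hc[of d] d num by (auto simp: J_group_def less_Suc_eq)
  moreover have "2 * m + 4 \<le> 3 * Suc d" "2 * k < Suc d" using num by simp_all
  moreover have "2 dvd fps_nth (h oo c) n" if "n < m" "odd n" "Suc d \<le> n" for n
    using hc[of n] hodd[of n] that by simp
  moreover have "2 dvd fps_nth (h oo c) m - \<alpha>"
    using hc[of m] hm num by simp
  ultimately show ?case
    using step.IH J_derived_compose[OF k hD c] by blast
qed

section \<open>Prescribing the leading coefficient in each degree\<close>

text \<open>For i = 4t + 3 the binomial coefficient is (4t + 3)(2t + 1), which is odd. The factors i
  - j and i + j - 1 differ by the odd number 2j - 1, so their product is even.\<close>

lemma odd_second_coeff:
  assumes "i mod 4 = 3" "j < i"
  shows "\<exists>r. of_nat (i choose 2) - of_nat (i - j) * of_nat (i + j - 1) = (1 + 2 * r :: 'a::comm_ring_1)"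
proof -
  obtain t where t: "i = 4 * t + 3"
    using assms(1) by (metis mult_div_mod_eq)
  have "i choose 2 = (4 * t + 3) * (2 * t + 1)"
    unfolding choose_two t by (simp add: algebra_simps)
  then have "odd (i choose 2)" by simp
  then obtain p where p: "i choose 2 = 2 * p + 1" by (rule oddE)
  have "even (i - j) \<or> even (i + j - 1)" using assms(2) by presburger
  then have "even ((i - j) * (i + j - 1))" by simp
  then obtain q where q: "(i - j) * (i + j - 1) = 2 * q" by (rule evenE)
  have "of_nat (i choose 2) - of_nat (i - j) * of_nat (i + j - 1) = (1 + 2 * (of_nat p - of_nat q) :: 'a)"
    unfolding of_nat_mult[symmetric] p q by (simp add: algebra_simps)
  then show ?thesis ..
qed

lemma leading_coeff_odd:
  fixes \<alpha> :: "'a::idom"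
  assumes "2 \<le> k" "k \<le> j" "odd m" "3 * j < m" "m mod 4 = (if even j then 1 else 3)"
  shows "\<exists>h \<in> derived (J_group k) (carrier (J_group k)). h \<in> carrier (J_group m) \<and> fps_nth h m = \<alpha>"
proof -
  \<comment> \<open>Places the second term of the commutator in degree m. The residue of m modulo 4
    is exactly what makes i = 3 mod 4.\<close>
  define i where "i = m - 2 * j + 2"
  have i: "j < i" "i mod 4 = 3" "m = i + 2 * j - 2" "j + 2 < i"
  proof -
    define n where "n = m - 2 * j"
    have n: "m = 2 * j + n" using assms(4) by (simp add: n_def)
    have "n mod 4 = 1"
    proof (cases "even j")
      case True
      then obtain b where "j = 2 * b" by (rule evenE)
      then show ?thesis using assms(5) unfolding n by simp
    next
      case False
      then obtain b where b: "j = 2 * b + 1" by (rule oddE)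
      then have "(4 * b + (n + 2)) mod 4 = 3" using assms(5) unfolding n by (simp add: algebra_simps)
      then show ?thesis by presburger
    qed
    then show "i mod 4 = 3" unfolding i_def n by (simp, presburger)
  qed (use assms(4) in \<open>simp_all add: i_def\<close>)
  define d where "d = i + j - 1"
  obtain r :: 'a where r: "of_nat (i choose 2) - of_nat (i - j) * of_nat d = 1 + 2 * r"
    using odd_second_coeff[OF i(2,1)] unfolding d_def by blast
  obtain h :: "'a fps" where h: "h \<in> derived (J_group k) (carrier (J_group k))"
    and nth: "\<And>n. n < d + min (i - 1) (2 * j - 2) \<Longrightarrow> fps_nth h n =
      fps_nth (fps_X + fps_const (of_nat (i - j) * \<alpha>) * fps_X ^ d
        + fps_const ((1 + 2 * r) * \<alpha>) * fps_X ^ m) n"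
    using commutator_nth[OF assms(1,2) i(1), of \<alpha>] unfolding d_def[symmetric] i(3)[symmetric] r
    by blast
  have nth': "fps_nth h n = fps_nth fps_X n + (if n = d then of_nat (i - j) * \<alpha> else 0)
      + (if n = m then (1 + 2 * r) * \<alpha> else 0)" if "n \<le> m" for n
  proof -
    \<comment> \<open>The degree m = d + j - 1 is within the precision, as j - 1 is below both i - 1
      and 2j - 2.\<close>
    have "n < d + min (i - 1) (2 * j - 2)" using that i assms(1,2) unfolding d_def min_def by auto
    then show ?thesis using nth by simp
  qed
  have d: "2 \<le> d" "d < m" using i assms(1,2) by (auto simp: d_def)
  have "h \<in> carrier (J_group d)"
    using d nth' by (simp add: in_J_group_iff)
  moreover have "2 dvd fps_nth h n" if "n < m" "odd n" "d \<le> n" for n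
  proof (cases "n = d")
    case True
    then have "even (i - j)" using that(2) i(1) unfolding d_def by presburger
    then have "2 dvd (of_nat (i - j) :: 'a)" by (metis evenE dvd_triv_left of_nat_mult of_nat_numeral)
    then show ?thesis using True d nth'[of n] by simp
  next
    case False
    then show ?thesis using that d nth'[of n] by simp
  qed
  moreover have "fps_nth h m - \<alpha> = 2 * (r * \<alpha>)"
    using nth'[of m] d by (simp add: algebra_simps)
  \<comment> \<open>The first inequality amounts to j + 3 \<le> i, that is, to 3j < m.\<close>
  moreover have "2 * m + 4 \<le> 3 * d" "2 * k < d"
    using i assms(2,4) unfolding d_def by linarith+
  ultimately show ?thesis
    using eliminate[OF assms(1,3) less_imp_le[OF d(2)]] h by (metis dvd_triv_left)
qed

text \<open>In this degree the only commutator with odd second coefficient also has an odd leading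
  coefficient and is itself one of the corrections. Its leading term is cancelled against that of
  the commutator with exponents \<open>k + 3\<close> and \<open>k\<close>.\<close>

lemma leading_coeff_exceptional:
  fixes \<alpha> :: "'a::idom"
  assumes "5 \<le> k" "k mod 4 = 1"
  shows "\<exists>h \<in> derived (J_group k) (carrier (J_group k)).
    h \<in> carrier (J_group (3 * k + 2)) \<and> fps_nth h (3 * k + 2) = \<alpha>"
proof -
  define d m where "d = 2 * k + 2" and "m = 3 * k + 2"
  have k: "2 \<le> k" and "odd m" using assms by (simp, unfold m_def, presburger)
  have "k \<le> k + 1" "k + 1 < k + 2" "k < k + 3" by simp_all
  have "(k + 2) mod 4 = 3" using assms(2) by presburger
  then obtain r :: 'a where
    r: "of_nat (k + 2 choose 2) - of_nat (k + 2 - (k + 1)) * of_nat (k + 2 + (k + 1) - 1) = 1 + 2 * r"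
    using odd_second_coeff[OF _ \<open>k + 1 < k + 2\<close>] by blast
  \<comment> \<open>The parameter 3\<alpha> matches the factor (k + 3) - k = 3 in the leading
    coefficient of the second commutator \<open>g\<close>, taken with -\<alpha>. As 3 is odd, the
    coefficient of \<open>f\<close> in degree m stays congruent to \<alpha> modulo 2.\<close>
  obtain f :: "'a fps" where f: "f \<in> derived (J_group k) (carrier (J_group k))"
    and f_nth: "\<And>n. n < k + 2 + (k + 1) - 1 + min (k + 2 - 1) (2 * (k + 1) - 2) \<Longrightarrow> fps_nth f n =
      fps_nth (fps_X + fps_const (of_nat (k + 2 - (k + 1)) * (3 * \<alpha>)) * fps_X ^ (k + 2 + (k + 1) - 1)
        + fps_const ((1 + 2 * r) * (3 * \<alpha>)) * fps_X ^ (k + 2 + 2 * (k + 1) - 2)) n"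
    using commutator_nth[OF k \<open>k \<le> k + 1\<close> \<open>k + 1 < k + 2\<close>, of "3 * \<alpha>"] unfolding r by blast
  obtain g :: "'a fps" and s :: 'a where g: "g \<in> derived (J_group k) (carrier (J_group k))"
    and g_nth: "\<And>n. n < k + 3 + k - 1 + min (k + 3 - 1) (2 * k - 2) \<Longrightarrow> fps_nth g n =
      fps_nth (fps_X + fps_const (of_nat (k + 3 - k) * - \<alpha>) * fps_X ^ (k + 3 + k - 1)
        + fps_const s * fps_X ^ (k + 3 + 2 * k - 2)) n"
    using commutator_nth[OF k order_refl \<open>k < k + 3\<close>, of "- \<alpha>"] by blast
  have f_nth': "fps_nth f n = fps_nth fps_X n + (if n = d then 3 * \<alpha> else 0)
      + (if n = m then (1 + 2 * r) * (3 * \<alpha>) else 0)" if "n \<le> m" for n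
  proof -
    have bound: "n < k + 2 + (k + 1) - 1 + min (k + 2 - 1) (2 * (k + 1) - 2)"
      using that assms(1) by (simp add: m_def min_def)
    have exps: "k + 2 + (k + 1) - 1 = d" "k + 2 + 2 * (k + 1) - 2 = m" "k + 2 - (k + 1) = 1"
      by (simp_all add: d_def m_def)
    show ?thesis using f_nth[OF bound, unfolded exps] by simp
  qed
  have g_nth': "fps_nth g n = fps_nth fps_X n - (if n = d then 3 * \<alpha> else 0)
      + (if n = m - 1 then s else 0)" if "n \<le> m" for n
  proof -
    have bound: "n < k + 3 + k - 1 + min (k + 3 - 1) (2 * k - 2)"
      using that assms(1) by (auto simp: m_def min_def)
    have exps: "k + 3 + k - 1 = d" "k + 3 + 2 * k - 2 = m - 1" "k + 3 - k = 3"
      by (simp_all add: d_def m_def)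
    show ?thesis using g_nth[OF bound, unfolded exps] by simp
  qed
  have d: "2 \<le> d" "d < m - 1" using assms(1) by (auto simp: d_def m_def)
  have fJ: "f \<in> carrier (J_group d)" and gJ: "g \<in> carrier (J_group d)"
    using f_nth' g_nth' d by (simp_all add: in_J_group_iff)
  have fg: "fps_nth (f oo g) n = (if n = m then (1 + 2 * r) * (3 * \<alpha>) else if n = m - 1 then s else 0)"
    if "2 \<le> n" "n \<le> m" for n
  proof -
    have "fps_nth (f oo g) n = fps_nth f n + fps_nth g n"
      using that by (intro J_compose_nth_add[OF d(1) fJ d(1) gJ]) (auto simp: d_def m_def)
    then show ?thesis using f_nth'[of n] g_nth'[of n] that d by auto
  qed
  have "f oo g \<in> carrier (J_group d)" by (rule J_compose_closed[OF d(1) fJ gJ])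
  then have "f oo g \<in> carrier (J_group (Suc d))"
    using fg[of d] d by (auto simp: J_group_def less_Suc_eq)
  \<comment> \<open>The leftover coefficient \<open>s\<close> is harmless: it sits in degree m - 1,
    which is even.\<close>
  moreover have "2 dvd fps_nth (f oo g) n" if "n < m" "odd n" "Suc d \<le> n" for n
    using fg[of n] that d \<open>odd m\<close> by auto
  moreover have "fps_nth (f oo g) m - \<alpha> = 2 * ((1 + 3 * r) * \<alpha>)"
    using fg[of m] d by (simp add: algebra_simps)
  \<comment> \<open>The elimination bound reads 6k + 8 \<le> 6k + 9 for \<open>Suc d\<close> and
    would fail for \<open>d\<close>, so degree d had to be cleared beforehand.\<close>
  moreover have "Suc d \<le> m" "2 * m + 4 \<le> 3 * Suc d" "2 * k < Suc d"
    using assms(1) by (auto simp: d_def m_def)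
  ultimately show ?thesis
    using eliminate[OF k \<open>odd m\<close>] J_derived_compose[OF k f g] unfolding m_def[symmetric]
    by (metis dvd_triv_left)
qed

lemma leading_coeff_even:
  fixes \<alpha> :: "'a::idom"
  assumes "2 \<le> k" "even m" "2 * k \<le> m"
  shows "\<exists>h \<in> derived (J_group k) (carrier (J_group k)). h \<in> carrier (J_group m) \<and> fps_nth h m = \<alpha>"
proof -
  obtain a where a: "m = 2 * a" using assms(2) by (rule evenE)
  obtain h where h: "h \<in> derived (J_group k) (carrier (J_group k))"
    and nth: "\<And>n. n \<le> m \<Longrightarrow> fps_nth h n = fps_nth (fps_X + fps_const \<alpha> * fps_X ^ m) n"
    using correction_even[of k a m \<alpha>] assms unfolding a by auto
  have "2 \<le> m" using assms by simp
  then have "h \<in> carrier (J_group m)" "fps_nth h m = \<alpha>"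
    using nth by (simp_all add: in_J_group_iff)
  then show ?thesis using h by blast
qed

text \<open>For odd m, the two residues modulo 4 are served by j = k and j = k + 1, the latter
  requiring m > 3k + 3. The value of \<open>c_index\<close> excludes the degrees that neither choice
  reaches, apart from m = 3k + 2 with k = 1 mod 4, which is treated separately.\<close>

lemma leading_coeff:
  fixes \<alpha> :: "'a::idom"
  assumes k: "2 \<le> k" and m: "c_index k \<le> m"
  shows "\<exists>h \<in> derived (J_group k) (carrier (J_group k)). h \<in> carrier (J_group m) \<and> fps_nth h m = \<alpha>"
proof -
  have km: "3 * k + 1 \<le> m" using m by (auto simp: c_index_def split: if_splits)
  consider "even m" | "odd m" "m mod 4 = (if even k then 1 else 3)"
    | "odd m" "3 * (k + 1) < m" "m mod 4 = (if even (k + 1) then 1 else 3)"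
    | "m = 3 * k + 2" "5 \<le> k" "k mod 4 = 1"
  proof (cases "even m \<or> m mod 4 = (if even k then 1 else 3)")
    case True
    then show thesis using that(1,2) by blast
  next
    case False
    then have "odd m" by blast
    then have mod_m: "m mod 4 = (if even (k + 1) then 1 else 3)"
      using False by (cases "even k") (simp_all, presburger+)
    show thesis
    proof (cases "even k")
      case True
      then have "m mod 4 = 3" using mod_m by simp
      then obtain p where p: "m = 4 * p + 3" by (metis mult_div_mod_eq)
      obtain q where q: "k = 2 * q" using True by (rule evenE)
      have "3 * (k + 1) < m"
      proof (cases "even q")
        case True
        then have "k mod 4 = 0" unfolding q by presburger
        then have "3 * k + 4 \<le> m" using m True q by (simp add: c_index_def)
        then show ?thesis by simp
      next
        case False
        then obtain b where b: "k = 4 * b + 2" unfolding q by (auto elim!: oddE)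
        then have "3 * k + 2 \<le> m" using m by (simp add: c_index_def split: if_splits)
        \<comment> \<open>Here 3k + 3 = 1 mod 4, so m = 3 mod 4 cannot equal it.\<close>
        then show ?thesis unfolding b p by presburger
      qed
      then show thesis using that(3) \<open>odd m\<close> mod_m by blast
    next
      case False
      then have "m mod 4 = 1" using mod_m by simp
      then obtain p where p: "m = 4 * p + 1" by (metis mult_div_mod_eq)
      obtain q where q: "k = 2 * q + 1" using False by (rule oddE)
      show thesis
      proof (cases "3 * (k + 1) < m")
        case True
        then show thesis using that(3) \<open>odd m\<close> mod_m by blast
      next
        case False
        \<comment> \<open>For odd k, both 3k + 1 and 3k + 3 are even, which leaves one odd
          degree.\<close>
        then have eq: "m = 3 * k + 2" using km unfolding p q by presburger
        then have "k mod 4 = 1" unfolding p by presburger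
        moreover from this have "5 \<le> k" using k by presburger
        ultimately show thesis using that(4) eq by blast
      qed
    qed
  qed
  then show ?thesis
  proof cases
    case 1
    show ?thesis using leading_coeff_even[OF k 1] km by simp
  next
    case 2
    show ?thesis using leading_coeff_odd[OF k order_refl 2(1) _ 2(2)] km by simp
  next
    case 3
    show ?thesis using leading_coeff_odd[OF k _ 3] by simp
  next
    case 4
    show ?thesis using leading_coeff_exceptional[OF 4(2,3)] unfolding 4(1) .
  qed
qed

section \<open>Successive approximation and closure\<close>

text \<open>Composing on the right with an element of the derived group that starts in degree N
  keeps the coefficients below N and adds its leading coefficient in degree N, so the defect there
  can be repaired.\<close>

lemma approximation_in_derived:
  fixes f :: "'a::idom fps"
  assumes k: "2 \<le> k" and f: "f \<in> carrier (J_group (c_index k))" and "c_index k \<le> N"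
  shows "\<exists>g \<in> derived (J_group k) (carrier (J_group k)). \<forall>n<N. fps_nth g n = fps_nth f n"
  using assms(3)
proof (induction N rule: dec_induct)
  case base
  have "fps_X \<in> derived (J_group k) (carrier (J_group k :: 'a fps monoid))"
    using subgroup.one_closed[OF J_derived_subgroup[OF k]] by (simp add: J_group_def)
  moreover have "2 \<le> c_index k" using k by (simp add: c_index_def)
  \<comment> \<open>Below degree \<open>c_index k\<close> the series f agrees with x, so the
    identity is a first approximation.\<close>
  ultimately show ?case using f by (metis in_J_group_iff)
next
  case (step N)
  then obtain g where g: "g \<in> derived (J_group k) (carrier (J_group k))"
    and gf: "\<forall>n<N. fps_nth g n = fps_nth f n" by blast
  have N: "2 \<le> N" using step(1) k by (auto simp: c_index_def split: if_splits)
  obtain h where h: "h \<in> derived (J_group k) (carrier (J_group k))" and hJ: "h \<in> carrier (J_group N)"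
    and hN: "fps_nth h N = fps_nth f N - fps_nth g N"
    using leading_coeff[OF k step(1)] by blast
  have gJ: "g \<in> carrier (J_group 2)"
    using g subgroup.subset[OF J_derived_subgroup[OF k]] J_group_antimono[OF k] by blast
  have "fps_nth (g oo h) n = fps_nth f n" if "n < Suc N" for n
  proof (cases "n < N")
    case True
    then show ?thesis using J_compose_nth[OF hJ True] gf by simp
  next
    case False
    then have "n = N" using that by simp
    then show ?thesis using J_compose_nth_add[OF order_refl gJ N hJ N] hN by simp
  qed
  then show ?case using J_derived_compose[OF k g h] by blast
qed

text \<open>A basic open set of the product topology restricts only finitely many coordinates; N is
  any bound for their indices.\<close>

lemma fps_topology_nhd_contains_congruent:
  assumes "topspace T = UNIV" "openin (fps_topology T) U" "f \<in> U"
  obtains N where "\<And>g. (\<forall>n<N. fps_nth g n = fps_nth f n) \<Longrightarrow> g \<in> U"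
proof -
  obtain W where W: "openin (product_topology (\<lambda>_. T) UNIV) W" "U = fps_nth -` W"
    using assms(2) unfolding fps_topology_def openin_pullback_topology by auto
  then obtain V where V: "finite {i. V i \<noteq> topspace T}" "fps_nth f \<in> Pi\<^sub>E UNIV V" "Pi\<^sub>E UNIV V \<subseteq> W"
    using assms(3) unfolding openin_product_topology_alt by auto
  obtain N where N: "\<forall>i \<in> {i. V i \<noteq> topspace T}. i < N"
    using V(1) unfolding finite_nat_set_iff_bounded by blast
  show thesis
  proof (rule that)
    fix g assume g: "\<forall>n<N. fps_nth g n = fps_nth f n"
    have "fps_nth g i \<in> V i" for i
    proof (cases "i < N")
      case True
      then show ?thesis using g V(2) by auto
    next
      case False
      then show ?thesis using N assms(1) by auto
    qed
    then show "g \<in> U" using V(3) W(2) by auto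
  qed
qed

theorem lemma2p2p11:
  fixes T :: "'a::{idom, ring_char_0} topology" and k :: nat
  assumes "hausdorff_ring_topology T" and "2 \<le> k"
  shows "carrier (J_group (c_index k)) \<subseteq> closed_commutator T k"
proof
  fix f :: "'a fps"
  assume f: "f \<in> carrier (J_group (c_index k))"
  have T: "topspace T = UNIV" using assms(1) by (simp add: hausdorff_ring_topology_def)
  have fk: "f \<in> carrier (J_group k)"
    using f J_group_antimono[of k "c_index k"] by (auto simp: c_index_def split: if_splits)
  have D: "derived (J_group k) (carrier (J_group k)) \<subseteq> carrier (J_group k :: 'a fps monoid)"
    using subgroup.subset[OF J_derived_subgroup[OF assms(2)]] .
  have "\<exists>g \<in> derived (J_group k) (carrier (J_group k)). g \<in> U"
    if U: "openin (J_topology T k) U" "f \<in> U" for U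
  proof -
    obtain V where V: "openin (fps_topology T) V" "U = V \<inter> carrier (J_group k)"
      using U(1) unfolding J_topology_def openin_subtopology by blast
    obtain N where N: "\<And>g. (\<forall>n<N. fps_nth g n = fps_nth f n) \<Longrightarrow> g \<in> V"
      using fps_topology_nhd_contains_congruent[OF T V(1), of f] U(2) V(2) by blast
    \<comment> \<open>The maximum meets the lower bound from which the approximation starts.\<close>
    obtain g where "g \<in> derived (J_group k) (carrier (J_group k))"
      "\<forall>n<max N (c_index k). fps_nth g n = fps_nth f n"
      using approximation_in_derived[OF assms(2) f, of "max N (c_index k)"] by auto
    then show ?thesis using N V(2) D by auto
  qed
  moreover have "f \<in> topspace (J_topology T k)"
    using fk T by (simp add: J_topology_def fps_topology_def topspace_pullback_topology)
  ultimately show "f \<in> closed_commutator T k"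
    unfolding closed_commutator_def in_closure_of by blast
qed

end
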